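(* For every real $q$ with $0<q<1$, $$\frac{(q^{4/3};q)_\infty^2\,(q^{5/6};q)_\infty}{(q;q)_\infty^2\,(q^{3/2};q)_\infty} =\sum_{n=0}^{\infty}(-1)^n\frac{(q^{1/3},q^{1/6};q)_n\,(q^{1/3},q^{1/3},q^{2/3};q^{1/2})_n}{(q,q;q)_n\,(q;q^{1/2})_{3n}}\,q^{\frac{n(9n+1)}{12}}$$ $$\times\left\{q^{n+\frac16}\,\frac{1-q^{n}}{1-q^{1/3}}+\frac{(1+q^{\frac n2+\frac16})(1-q^{\frac{5n}2+\frac13})}{(1+q^{1/6})(1-q^{1/3})}\right\}.$$
   Context: For a base $p$: $(x;p)_0=1$, $(x;p)_n=\prod_{j=0}^{n-1}(1-p^jx)$, $(x;p)_\infty=\prod_{j\ge0}(1-p^jx)$, and $(x_1,\dots,x_r;p)_n=(x_1;p)_n\cdots(x_r;p)_n$. Fractional powers of $q$ are the positive real ones. *)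

theory Defs
  imports "HOL-Analysis.Analysis"
begin

definition qpoch :: "real \<Rightarrow> real \<Rightarrow> nat \<Rightarrow> real" where
  "qpoch x p n = (\<Prod>j<n. 1 - p ^ j * x)"

definition qpoch_inf :: "real \<Rightarrow> real \<Rightarrow> real" where
  "qpoch_inf x p = (\<Prod>j. 1 - p ^ j * x)"

definition qpochs :: "real list \<Rightarrow> real \<Rightarrow> nat \<Rightarrow> real" where
  "qpochs xs p n = (\<Prod>x\<leftarrow>xs. qpoch x p n)"

end

theory Submission
  imports Defs
begin

text \<open>Put \<open>t = q powr (1/6)\<close>, \<open>p = t^3\<close>, \<open>a = b = t^2\<close>, \<open>e = p / b\<close>. The quadratic summation of Gasper and Rahman
  (the limiting case with summand proportional to
  \<open>(1 - a p^(3j)) (a,b,e;p)_j (1/c;p^2)_j / ((p^2,ape,abp;p^2)_j (apc;p)_j) (ac)^j p^(j(j+1)/2)\<close>)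
  becomes, after division by its value, a WZ pair for the dilation \<open>c -> c p^2\<close>. Summing the WZ equation
  along the diagonal \<open>n = j\<close> rather than along \<open>n = const\<close> gives, at \<open>c = t\<close>, the terms of the theorem: the two
  summands of the bracket combine the last summand and the boundary value of the certificate. Hence
  the partial sums of the series are \<open>\<Sum>j\<le>n\<close> of the summand at \<open>c p^(2n)\<close>, and Tannery's theorem
  gives their limit up to the sum at \<open>c = 0\<close>. That sum does not depend on the initial \<open>c\<close>, and \<open>c = 1\<close>,
  where everything terminates, determines it.\<close>

section \<open>Finite and infinite q-shifted factorials\<close>

lemma qpoch_0 [simp]: "qpoch x p 0 = 1"
  by (simp add: qpoch_def)

lemma qpoch_Suc: "qpoch x p (Suc n) = qpoch x p n * (1 - p ^ n * x)"
  by (simp add: qpoch_def)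

lemma qpoch_add: "qpoch x p (m + n) = qpoch x p m * qpoch (p ^ m * x) p n"
  by (induction n) (auto simp: qpoch_Suc power_add mult_ac)

lemma qpoch_double: "qpoch x p (2 * n) = qpoch x (p\<^sup>2) n * qpoch (p * x) (p\<^sup>2) n"
  by (induction n) (auto simp: qpoch_Suc power_mult power2_eq_square power_mult_distrib mult_ac)

text \<open>Both sides are \<open>qpoch x p (Suc n)\<close>, with the first or the last factor split
  off.\<close>

lemma qpoch_shift: "(1 - x) * qpoch (p * x) p n = qpoch x p n * (1 - p ^ n * x)"
  by (induction n) (auto simp: qpoch_Suc mult_ac)

lemma qpoch_pos:
  assumes "0 \<le> p" "p < 1" "x < 1"
  shows "0 < qpoch x p n"
proof -
  have "p ^ j * x < 1" for j
  proof (cases "0 \<le> x")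
    case True
    have "p ^ j * x \<le> 1 * x"
      using assms True by (intro mult_right_mono power_le_one) auto
    thus ?thesis using assms by simp
  next
    case False
    have "p ^ j * x \<le> 0"
      using assms False by (intro mult_nonneg_nonpos) auto
    thus ?thesis by simp
  qed
  thus ?thesis unfolding qpoch_def by (intro prod_pos) (auto simp: algebra_simps)
qed

lemma qpoch_mem_unit:
  assumes "0 \<le> p" "p < 1" "0 \<le> x" "x \<le> 1"
  shows "qpoch x p n \<in> {0..1}"
proof -
  have "p ^ j * x \<le> 1" "0 \<le> p ^ j * x" for j
    using assms by (auto intro!: mult_le_one power_le_one)
  thus ?thesis unfolding qpoch_def by (auto intro!: prod_nonneg prod_le_1)
qed

lemma qpoch_antimono_arg:
  assumes "0 \<le> p" "p < 1" "x \<le> y" "y \<le> 1" "0 \<le> y"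
  shows "qpoch y p n \<le> qpoch x p n"
  unfolding qpoch_def
proof (rule prod_mono)
  fix i assume "i \<in> {..<n}"
  have "p ^ i * x \<le> p ^ i * y" "p ^ i * y \<le> 1"
    using assms by (auto intro!: mult_left_mono mult_le_one power_le_one)
  thus "0 \<le> 1 - p ^ i * y \<and> 1 - p ^ i * y \<le> 1 - p ^ i * x" by simp
qed

lemma convergent_prod_qpoch:
  fixes p x :: real
  assumes "0 \<le> p" "p < 1"
  shows "convergent_prod (\<lambda>j. 1 - p ^ j * x)"
proof -
  have "summable (\<lambda>j. norm (p ^ j) * \<bar>x\<bar>)"
    using assms by (intro summable_mult2) (simp add: summable_geometric)
  thus ?thesis
    by (intro abs_convergent_prod_imp_convergent_prod summable_imp_abs_convergent_prod)
       (simp add: abs_mult)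
qed

lemma qpoch_LIMSEQ:
  assumes "0 \<le> p" "p < 1"
  shows "qpoch x p \<longlonglongrightarrow> qpoch_inf x p"
  using has_prod_imp_tendsto'[OF convergent_prod_has_prod[OF convergent_prod_qpoch[OF assms]]]
  by (simp add: qpoch_def [abs_def] qpoch_inf_def)

lemma qpoch_inf_pos:
  assumes "0 \<le> p" "p < 1" "x < 1"
  shows "0 < qpoch_inf x p"
  unfolding qpoch_inf_def
proof (rule less_0_prodinf[OF convergent_prod_qpoch])
  fix i show "0 < 1 - p ^ i * x"
    using qpoch_pos[OF assms, of i] qpoch_pos[OF assms, of "Suc i"]
    by (auto simp: qpoch_Suc zero_less_mult_iff)
qed (use assms in auto)

lemma qpoch_inf_le:
  assumes "0 \<le> p" "p < 1" "0 \<le> x" "x \<le> 1"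
  shows "qpoch_inf x p \<le> qpoch x p n"
proof (rule decseq_ge[OF _ qpoch_LIMSEQ])
  have "qpoch x p (Suc n) \<le> qpoch x p n" for n
    using qpoch_mem_unit[OF assms, of n] assms
    by (simp add: qpoch_Suc mult_left_le)
  thus "decseq (qpoch x p)" by (intro decseq_SucI)
qed (use assms in auto)

section \<open>A WZ pair for the quadratic summation\<close>

text \<open>Keeping \<open>e\<close> as a parameter next to \<open>b\<close> avoids the quotient
  \<open>p / b\<close> and shows the symmetry between \<open>b\<close> and \<open>e\<close>.\<close>

locale quadratic_wz =
  fixes p a b e :: real
  assumes p: "0 < p" "p < 1" and a: "0 < a" "a < 1"
    and b: "0 < b" "b \<le> 1" and e: "0 < e" "e \<le> 1"
    and p_eq: "p = b * e"
begin

text \<open>The last product is \<open>a ^ j * p ^ (j * (j + 1) / 2)\<close>; the power of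
  \<open>c\<close> that goes with it sits in \<open>shifted\<close>. Dividing by
  \<open>1 - a\<close> makes the summand at \<open>j = 0\<close> equal to 1.\<close>

definition numer where
  "numer j = qpoch a p j * qpoch b p j * qpoch e p j * (\<Prod>i<j. a * p ^ Suc i) / (1 - a)"

definition denom where
  "denom j = qpoch (p\<^sup>2) (p\<^sup>2) j * qpoch (a * p * e) (p\<^sup>2) j * qpoch (a * b * p) (p\<^sup>2) j"

text \<open>\<open>shifted c j\<close> is \<open>c ^ j * qpoch (1 / c) (p\<^sup>2) j\<close>, written so that it makes sense at
  \<open>c = 0\<close>, the point to which the dilations \<open>c * p ^ (2 * n)\<close> converge.\<close>

definition shifted where
  "shifted c j = (\<Prod>i<j. c - p ^ (2 * i))"

definition summand where
  "summand c j = (1 - a * p ^ (3 * j)) * numer j * shifted c j / (denom j * qpoch (a * p * c) p j)"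

text \<open>The WZ certificate. As a rational multiple of \<open>summand c (Suc i)\<close> it would
  need division by \<open>c - p ^ (2 * i)\<close>, which can vanish; the index \<open>i\<close> in
  \<open>shifted\<close> and \<open>denom\<close> avoids this.\<close>

definition cert where
  "cert c j = (case j of 0 \<Rightarrow> 0 | Suc i \<Rightarrow>
     c * numer (Suc i) * shifted c i / (denom i * qpoch (a * p * c) p (i + 2)))"

text \<open>For \<open>c\<close> in the unit interval this is the quotient of the infinite products
  \<open>weight_inf\<close> at \<open>c\<close> and at \<open>c * p ^ (2 * n)\<close>; it
  compensates the dilation of \<open>c\<close>.\<close>

definition weight where
  "weight c n = qpoch (a * b * p * c) (p\<^sup>2) n * qpoch (a * e * p * c) (p\<^sup>2) n / qpoch (a * p * c) p (2 * n)"

lemma numer_Suc: "numer (Suc j) =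
    numer j * ((1 - p^j * a) * (1 - p^j * b) * (1 - p^j * e) * (a * p ^ Suc j))"
  by (simp add: numer_def qpoch_Suc)

lemma denom_Suc: "denom (Suc j) =
    denom j * ((1 - p^(2*j) * p\<^sup>2) * (1 - p^(2*j) * (a * p * e)) * (1 - p^(2*j) * (a * b * p)))"
  by (simp add: denom_def qpoch_Suc power_mult)

lemma shifted_Suc: "shifted c (Suc j) = shifted c j * (c - p ^ (2*j))"
  by (simp add: shifted_def)

text \<open>Every factor of the dilated product except the first, \<open>c * p\<^sup>2 - 1\<close>,
  is \<open>p\<^sup>2\<close> times the preceding factor of the product for
  \<open>c\<close>.\<close>

lemma shifted_dilate: "shifted (c * p\<^sup>2) (Suc j) = p ^ (2*j) * (c * p\<^sup>2 - 1) * shifted c j"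
proof (induction j)
  case 0 thus ?case by (simp add: shifted_def)
next
  case (Suc j)
  have "shifted (c * p\<^sup>2) (Suc (Suc j)) = shifted (c * p\<^sup>2) (Suc j) * (c * p\<^sup>2 - p ^ (2 * Suc j))"
    by (rule shifted_Suc)
  also have "\<dots> = p ^ (2*j) * (c * p\<^sup>2 - 1) * shifted c j * (p\<^sup>2 * (c - p ^ (2*j)))"
    by (subst Suc) (simp add: algebra_simps power_add power2_eq_square)
  finally show ?case by (simp add: shifted_Suc power_add power2_eq_square mult_ac)
qed

lemma ape: "0 < a * p * e" "a * p * e < 1" and abp: "0 < a * b * p" "a * b * p < 1"
  and ap: "0 < a * p" "a * p < 1"
proof -
  have h: "x * y < 1" if "0 < x" "x < 1" "0 < y" "y \<le> 1" for x y :: real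
    using that by (meson less_le_trans mult_left_le order.strict_trans1 less_imp_le)
  show ap: "0 < a * p" "a * p < 1" using p a h[of a p] by auto
  show "0 < a * p * e" "a * p * e < 1" using ap e h[of "a * p" e] by auto
  show "0 < a * b * p" "a * b * p < 1" using ap b h[of "a * p" b] a p by (auto simp: mult_ac)
qed

lemma p2: "0 \<le> p\<^sup>2" "p\<^sup>2 < 1"
  using p by (auto simp: power_less_one_iff)

lemma c_mult: "0 \<le> c \<Longrightarrow> c \<le> 1 \<Longrightarrow> 0 < x \<Longrightarrow> x < 1 \<Longrightarrow> 0 \<le> x * c \<and> x * c \<le> x \<and> x * c < (1::real)"
  by (meson less_imp_le mult_left_le mult_nonneg_nonneg order.strict_trans1)

lemma denom_pos: "0 < denom j"
  unfolding denom_def using ape abp p2 by (intro mult_pos_pos qpoch_pos) auto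

lemma qpoch_apc_pos: "0 \<le> c \<Longrightarrow> c \<le> 1 \<Longrightarrow> 0 < qpoch (a * p * c) p j"
  using ap p c_mult[of c "a * p"] by (intro qpoch_pos) auto

text \<open>The WZ equation: removing the common products leaves a polynomial identity in
  \<open>p ^ j\<close> and the parameters. The case \<open>j = 0\<close> is separate because there
  the certificate has its default value 0.\<close>

lemma wz:
  assumes c: "0 \<le> c" "c \<le> 1"
  shows "summand (c * p\<^sup>2) j * weight c 1 - summand c j = cert c (Suc j) - cert c j"
proof -
  define x where "x = p ^ j"
  define Q where "Q = qpoch (a * p * c) p j"
  have Q: "Q > 0" using qpoch_apc_pos[OF c] by (simp add: Q_def)
  have Q1: "qpoch (a * p * c) p (Suc j) = Q * (1 - x * (a * p * c))"
    by (simp add: Q_def qpoch_Suc x_def)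
  have Q2: "qpoch (a * p * c) p (Suc (Suc j)) = Q * (1 - x * (a * p * c)) * (1 - p * x * (a * p * c))"
    by (simp add: qpoch_Suc[of _ _ "Suc j"] Q1) (simp add: x_def)
  have nz1: "1 - x * (a * p * c) \<noteq> 0" "1 - p * x * (a * p * c) \<noteq> 0"
    using Q2 qpoch_apc_pos[OF c, of "Suc (Suc j)"] by auto
  have nz2: "1 - a * p * c \<noteq> 0" "1 - p * (a * p * c) \<noteq> 0"
    using qpoch_apc_pos[OF c, of "2"] by (auto simp: numeral_2_eq_2 qpoch_Suc)
  have "qpoch (a * p * c) p (2 + j) = (1 - a * p * c) * (1 - p * (a * p * c)) * qpoch (p\<^sup>2 * (a * p * c)) p j"
    unfolding qpoch_add by (simp add: numeral_2_eq_2 qpoch_Suc)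
  \<comment> \<open>Two ways of splitting the product with \<open>j + 2\<close> factors: two off the
    front, or two off the back.\<close>
  hence Qd: "qpoch (a * p * (c * p\<^sup>2)) p j =
     Q * (1 - x * (a * p * c)) * (1 - p * x * (a * p * c)) / ((1 - a * p * c) * (1 - p * (a * p * c)))"
    using nz2 Q2 by (simp add: eq_divide_eq add.commute mult_ac)
  have W1: "weight c 1 = (1 - a * b * p * c) * (1 - a * e * p * c) / ((1 - a * p * c) * (1 - p * (a * p * c)))"
    by (simp add: weight_def qpoch_Suc numeral_2_eq_2)
  have TW: "summand (c * p\<^sup>2) j * weight c 1 = (1 - a * x ^ 3) * numer j * shifted (c * p\<^sup>2) j *
     ((1 - a * b * p * c) * (1 - a * e * p * c)) / (denom j * Q * (1 - x * (a * p * c)) * (1 - p * x * (a * p * c)))"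
    unfolding summand_def Qd W1 using nz1 nz2 Q denom_pos[of j]
    by (simp add: x_def power_mult mult.commute[of 3])
  have T0: "summand c j = (1 - a * x ^ 3) * numer j * shifted c j / (denom j * Q)"
    by (simp add: summand_def Q_def x_def power_mult mult.commute[of 3])
  have GS: "cert c (Suc j) = c * numer (Suc j) * shifted c j / (denom j * (Q * (1 - x * (a * p * c)) * (1 - p * x * (a * p * c))))"
    using Q2 by (simp add: cert_def)
  show ?thesis
  proof (cases j)
    case 0
    hence [simp]: "x = 1" "Q = 1" by (auto simp: x_def Q_def)
    show ?thesis unfolding TW T0 GS using nz1 nz2 denom_pos[of 0] unfolding 0
      by (simp add: cert_def numer_Suc shifted_def denom_def divide_simps) (simp add: p_eq, algebra)
  next
    case (Suc i)
    \<comment> \<open>The certificate at \<open>j\<close> involves products of length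
      \<open>i = j - 1\<close>, so \<open>p ^ i\<close> is the variable in which everything is
      polynomial.\<close>
    define y where "y = p ^ i"
    have x: "x = p * y" by (simp add: x_def y_def Suc)
    have yy: "p ^ (2 * i) = y\<^sup>2" "p ^ i = y" by (auto simp: y_def power_mult mult.commute[of 2])
    define D where "D = denom i"
    define N where "N = numer j"
    define S where "S = shifted c i"
    define d1 where "d1 = (1 - y\<^sup>2 * p\<^sup>2) * (1 - y\<^sup>2 * (a * p * e)) * (1 - y\<^sup>2 * (a * b * p))"
    define q1 where "q1 = 1 - x * (a * p * c)"
    define q2 where "q2 = 1 - p * x * (a * p * c)"
    have dj: "denom j = D * d1" by (simp add: Suc denom_Suc D_def d1_def yy)
    have nz: "D \<noteq> 0" "d1 \<noteq> 0" "q1 \<noteq> 0" "q2 \<noteq> 0" "Q \<noteq> 0"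
      using denom_pos[of i] denom_pos[of j] dj nz1 Q by (auto simp: D_def q1_def q2_def)
    have Gj: "cert c j = c * N * S / (D * (Q * q1))"
      using Q1 by (simp add: cert_def Suc N_def S_def D_def q1_def)
    have GS': "cert c (Suc j) = c * (N * ((1 - x * a) * (1 - x * b) * (1 - x * e) * (a * (p * x)))) * (S * (c - y\<^sup>2))
        / (D * d1 * (Q * q1 * q2))"
      unfolding GS numer_Suc dj q1_def q2_def by (simp add: Suc shifted_Suc yy N_def S_def x)
    have TW': "summand (c * p\<^sup>2) j * weight c 1 = (1 - a * x ^ 3) * N * (y\<^sup>2 * (c * p\<^sup>2 - 1) * S) *
     ((1 - a * b * p * c) * (1 - a * e * p * c)) / (D * d1 * Q * q1 * q2)"
      unfolding TW dj q1_def q2_def by (simp add: Suc shifted_dilate yy N_def S_def)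
    have T0': "summand c j = (1 - a * x ^ 3) * N * (S * (c - y\<^sup>2)) / (D * d1 * Q)"
      unfolding T0 dj by (simp add: Suc shifted_Suc yy N_def S_def)
    \<comment> \<open>The WZ equation without the common factor
      \<open>N * S / (D * d1 * Q * q1 * q2)\<close>, polynomial in \<open>a\<close>,
      \<open>b\<close>, \<open>c\<close>, \<open>e\<close>, \<open>y\<close> after
      \<open>p = b * e\<close>.\<close>
    have poly: "(1 - a * x ^ 3) * (y\<^sup>2 * (c * p\<^sup>2 - 1)) * ((1 - a * b * p * c) * (1 - a * e * p * c))
        - (1 - a * x ^ 3) * (c - y\<^sup>2) * q1 * q2
        = c * ((1 - x * a) * (1 - x * b) * (1 - x * e) * (a * (p * x))) * (c - y\<^sup>2) - c * d1 * q2"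
      unfolding q1_def q2_def d1_def x p_eq by algebra
    have "summand (c * p\<^sup>2) j * weight c 1 - summand c j = N * S / (D * d1 * Q * q1 * q2) *
       ((1 - a * x ^ 3) * (y\<^sup>2 * (c * p\<^sup>2 - 1)) * ((1 - a * b * p * c) * (1 - a * e * p * c))
        - (1 - a * x ^ 3) * (c - y\<^sup>2) * q1 * q2)"
      unfolding TW' T0' using nz by (simp add: divide_simps) (simp add: algebra_simps)
    also have "\<dots> = cert c (Suc j) - cert c j"
      unfolding poly Gj GS' using nz by (simp add: divide_simps) (simp add: algebra_simps)
    finally show ?thesis .
  qed
qed

lemma weight_Suc: "weight c (Suc n) = weight c n * weight (c * p ^ (2 * n)) 1"
proof -
  have "qpoch (a * p * c) p (2 * Suc n) = qpoch (a * p * c) p (2 * n) * qpoch (a * p * (c * p ^ (2 * n))) p 2"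
    using qpoch_add[of "a * p * c" p "2 * n" 2] by (simp add: mult_ac)
  thus ?thesis
    unfolding weight_def
    by (simp add: qpoch_Suc power_mult [symmetric] del: mult_Suc_right) (simp add: mult_ac)
qed

section \<open>Summation of the WZ equation along the diagonal\<close>

definition diag_sum where
  "diag_sum c n = (\<Sum>j\<le>n. summand (c * p ^ (2 * n)) j * weight c n)"

lemma c_power:
  assumes "0 \<le> c" "c \<le> 1"
  shows "0 \<le> c * p ^ n" "c * p ^ n \<le> 1"
  using assms p by (auto intro!: mult_le_one power_le_one)

text \<open>The WZ equation at \<open>c * p ^ (2 * n)\<close>, multiplied by
  \<open>weight c n\<close>, telescopes in \<open>j\<close>; since the certificate vanishes at 0,
  only the upper boundary term remains.\<close>

lemma wz_sum:
  assumes "0 \<le> c" "c \<le> 1"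
  shows "(\<Sum>j\<le>m. summand (c * p ^ (2 * Suc n)) j * weight c (Suc n)) =
    (\<Sum>j\<le>m. summand (c * p ^ (2 * n)) j * weight c n) + weight c n * cert (c * p ^ (2 * n)) (Suc m)"
proof -
  let ?c = "c * p ^ (2 * n)"
  have "summand (c * p ^ (2 * Suc n)) j * weight c (Suc n) - summand ?c j * weight c n
      = weight c n * (cert ?c (Suc j) - cert ?c j)" for j
  proof -
    have e: "c * p ^ (2 * Suc n) = ?c * p\<^sup>2"
      by (simp add: power_add power2_eq_square mult_ac)
    show ?thesis
      unfolding e weight_Suc wz[OF c_power[OF assms], symmetric]
      by (simp only: right_diff_distrib mult_ac)
  qed
  hence "(\<Sum>j\<le>m. summand (c * p ^ (2 * Suc n)) j * weight c (Suc n)) - (\<Sum>j\<le>m. summand ?c j * weight c n)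
     = weight c n * (\<Sum>j\<le>m. cert ?c (Suc j) - cert ?c j)"
    by (simp add: sum_subtractf [symmetric] sum_distrib_left)
  also have "(\<Sum>j\<le>m. cert ?c (Suc j) - cert ?c j) = cert ?c (Suc m)"
    using sum_lessThan_telescope[of "cert ?c" "Suc m"] by (simp add: lessThan_Suc_atMost cert_def)
  finally show ?thesis by simp
qed

lemma diag_sum_0: "diag_sum c 0 = 1"
  using a by (simp add: diag_sum_def summand_def weight_def numer_def denom_def shifted_def)

text \<open>First the dilation index moves with the range of \<open>j\<close> fixed, which costs a
  boundary term, then the range grows by one. Together the two extra terms will be the summand of
  the theorem.\<close>

lemma diag_sum_Suc:
  assumes "0 \<le> c" "c \<le> 1"
  shows "diag_sum c (Suc n) = diag_sum c n + weight c n * cert (c * p ^ (2 * n)) (Suc n)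
    + summand (c * p ^ (2 * Suc n)) (Suc n) * weight c (Suc n)"
proof -
  have "diag_sum c (Suc n) = (\<Sum>j\<le>n. summand (c * p ^ (2 * Suc n)) j * weight c (Suc n))
      + summand (c * p ^ (2 * Suc n)) (Suc n) * weight c (Suc n)"
    unfolding diag_sum_def by (rule sum.atMost_Suc)
  thus ?thesis
    unfolding wz_sum[OF assms] diag_sum_def by simp
qed

text \<open>At \<open>c = 1\<close> the factor \<open>shifted (p ^ (2 * n))\<close> terminates the series, so the diagonal sum does
  not change with \<open>n\<close>; this evaluates the limiting series at \<open>c = 0\<close> without any further summation formula.\<close>

lemma diag_sum_1: "diag_sum 1 n = 1"
proof (induction n)
  case 0 show ?case by (rule diag_sum_0)
next
  case (Suc n)
  have z: "shifted (1 * p ^ (2 * n)) (Suc n) = 0"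
    by (simp add: shifted_Suc)
  have "diag_sum 1 (Suc n) = (\<Sum>j\<le>Suc n. summand (1 * p ^ (2 * n)) j * weight 1 n)
      + weight 1 n * cert (1 * p ^ (2 * n)) (Suc (Suc n))"
    unfolding diag_sum_def by (rule wz_sum) auto
  also have "\<dots> = diag_sum 1 n"
    using z by (simp add: cert_def summand_def diag_sum_def)
  finally show ?case using Suc by simp
qed

section \<open>The limit of the diagonal sums\<close>

definition weight_inf where
  "weight_inf c = qpoch_inf (a * b * p * c) (p\<^sup>2) * qpoch_inf (a * e * p * c) (p\<^sup>2) / qpoch_inf (a * p * c) p"

lemma weight_inf_pos: "0 \<le> c \<Longrightarrow> c \<le> 1 \<Longrightarrow> 0 < weight_inf c"
  unfolding weight_inf_def using p p2 ap abp ape c_mult[of c "a * b * p"] c_mult[of c "a * p * e"] c_mult[of c "a * p"]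
  by (intro divide_pos_pos mult_pos_pos qpoch_inf_pos) (auto simp: mult_ac)

lemma weight_LIMSEQ:
  assumes "0 \<le> c" "c \<le> 1"
  shows "weight c \<longlonglongrightarrow> weight_inf c"
  unfolding weight_inf_def weight_def [abs_def]
proof (intro tendsto_divide tendsto_mult qpoch_LIMSEQ p2)
  show "(\<lambda>n. qpoch (a * p * c) p (2 * n)) \<longlonglongrightarrow> qpoch_inf (a * p * c) p"
    using LIMSEQ_subseq_LIMSEQ[OF qpoch_LIMSEQ, of p "\<lambda>n. 2 * n" "a * p * c"] p
    by (auto simp: strict_mono_def o_def)
  show "qpoch_inf (a * p * c) p \<noteq> 0"
    using qpoch_inf_pos[of p "a * p * c"] p ap c_mult[of c "a * p"] assms by force
qed

text \<open>The majorant must be uniform in \<open>c\<close>, because \<open>c * p ^ (2 * n)\<close>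
  moves with \<open>n\<close>. The factor \<open>a ^ j\<close> comes from \<open>numer\<close>; the
  other numerators are at most 1 in absolute value, and the denominators stay above positive
  infinite products.\<close>

lemma summand_bound:
  obtains K where "\<And>c j. 0 \<le> c \<Longrightarrow> c \<le> 1 \<Longrightarrow> \<bar>summand c j\<bar> \<le> K * a ^ j"
proof -
  define d where "d = qpoch_inf (p\<^sup>2) (p\<^sup>2) * qpoch_inf (a * p * e) (p\<^sup>2) * qpoch_inf (a * b * p) (p\<^sup>2)"
  define s where "s = qpoch_inf (a * p) p"
  have d: "0 < d" and s: "0 < s"
    unfolding d_def s_def using p p2 ap abp ape by (auto intro!: mult_pos_pos qpoch_inf_pos)
  have dj: "d \<le> denom j" for j
    unfolding d_def denom_def using p2 abp ape p a b e
    by (intro mult_mono qpoch_inf_le mult_nonneg_nonneg less_imp_le[OF qpoch_pos] less_imp_le[OF qpoch_inf_pos]) auto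
  have "\<bar>summand c j\<bar> \<le> 1 / ((1 - a) * (d * s)) * a ^ j" if c: "0 \<le> c" "c \<le> 1" for c j
  proof -
    have "s \<le> qpoch (a * p) p j"
      unfolding s_def using p ap by (intro qpoch_inf_le) auto
    also have "\<dots> \<le> qpoch (a * p * c) p j"
      using p ap c_mult[OF c, of "a * p"] by (intro qpoch_antimono_arg) auto
    finally have den: "d * s \<le> denom j * qpoch (a * p * c) p j"
      using dj[of j] d s by (intro mult_mono) auto
    have "\<bar>1 - a * p ^ (3 * j)\<bar> \<le> 1"
      using a p by (auto simp: abs_le_iff mult_le_one power_le_one intro: order_trans[of _ 1])
    moreover have "\<bar>numer j\<bar> \<le> a ^ j / (1 - a)"
    proof -
      have u: "qpoch x p j \<in> {0..1}" if "0 \<le> x" "x \<le> 1" for x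
        using that p by (intro qpoch_mem_unit) auto
      have ua: "qpoch a p j \<in> {0..1}" "qpoch b p j \<in> {0..1}" "qpoch e p j \<in> {0..1}"
        using a b e by (auto intro!: u simp del: atLeastAtMost_iff)
      have "(\<Prod>i<j. a * p ^ Suc i) \<le> (\<Prod>i<j. a)"
        using a p by (intro prod_mono) (auto intro!: mult_left_le mult_le_one power_le_one)
      moreover have "0 \<le> (\<Prod>i<j. a * p ^ Suc i)"
        using a p by (intro prod_nonneg) auto
      ultimately have "\<bar>qpoch a p j * qpoch b p j * qpoch e p j * (\<Prod>i<j. a * p ^ Suc i)\<bar> \<le> 1 * 1 * 1 * a ^ j"
        unfolding abs_mult using ua by (intro mult_mono) auto
      thus ?thesis using a by (simp add: numer_def divide_right_mono)
    qed
    moreover have "\<bar>shifted c j\<bar> \<le> 1"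
    proof -
      have "\<bar>c - p ^ (2 * i)\<bar> \<le> 1" for i
        using c p power_le_one[of p "2 * i"] zero_le_power[of p "2 * i"] by linarith
      thus ?thesis unfolding shifted_def abs_prod by (intro prod_le_1) auto
    qed
    ultimately have "\<bar>(1 - a * p ^ (3 * j)) * numer j * shifted c j\<bar> \<le> 1 * (a ^ j / (1 - a)) * 1"
      unfolding abs_mult using a by (intro mult_mono) auto
    hence "\<bar>summand c j\<bar> \<le> 1 * (a ^ j / (1 - a)) * 1 / (d * s)"
      unfolding summand_def abs_divide using den d s by (intro frac_le) auto
    thus ?thesis by (simp add: mult_ac)
  qed
  thus ?thesis using that by blast
qed

lemma diag_sum_LIMSEQ_aux:
  assumes c: "0 \<le> c" "c \<le> 1"
  shows "diag_sum c \<longlonglongrightarrow> (\<Sum>j. summand 0 j * weight_inf c)"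
proof -
  obtain K where K: "\<And>c j. 0 \<le> c \<Longrightarrow> c \<le> 1 \<Longrightarrow> \<bar>summand c j\<bar> \<le> K * a ^ j"
    using summand_bound by blast
  obtain B where B: "\<And>n. \<bar>weight c n\<bar> \<le> B"
    using weight_LIMSEQ[OF c] by (metis BseqE convergentI convergent_imp_Bseq real_norm_def)
  \<comment> \<open>Padding with zeros turns the sums of growing length into series with a common
    majorant, as Tannery's theorem requires.\<close>
  let ?f = "\<lambda>j n. if j \<le> n then summand (c * p ^ (2 * n)) j * weight c n else 0"
  have c0: "(\<lambda>n. c * p ^ (2 * n)) \<longlonglongrightarrow> 0"
    using p p2 by (auto simp: power_mult intro!: tendsto_mult_right_zero LIMSEQ_power_zero)
  have lim: "?f j \<longlonglongrightarrow> summand 0 j * weight_inf c" for j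
  proof -
    have "(\<lambda>n. summand (c * p ^ (2 * n)) j) \<longlonglongrightarrow> summand 0 j"
      unfolding summand_def shifted_def qpoch_def using denom_pos[of j] 
      by (intro tendsto_intros c0) auto
    hence "(\<lambda>n. summand (c * p ^ (2 * n)) j * weight c n) \<longlonglongrightarrow> summand 0 j * weight_inf c"
      by (intro tendsto_mult weight_LIMSEQ c)
    moreover have "\<forall>\<^sub>F n in sequentially. summand (c * p ^ (2 * n)) j * weight c n = ?f j n"
      using eventually_ge_at_top[of j] by eventually_elim simp
    ultimately show ?thesis by (rule Lim_transform_eventually)
  qed
  have bd: "norm (?f j n) \<le> K * a ^ j * B" for j n
  proof -
    have KT: "\<bar>summand (c * p ^ (2 * n)) j\<bar> \<le> K * a ^ j"
      by (intro K c_power c)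
    have "\<bar>summand (c * p ^ (2 * n)) j\<bar> * \<bar>weight c n\<bar> \<le> K * a ^ j * B"
      using KT B[of n] by (intro mult_mono) auto
    moreover from this have "0 \<le> K * a ^ j * B"
      by (rule order_trans[rotated]) simp
    ultimately show ?thesis by (simp add: abs_mult)
  qed
  have "(\<lambda>n. suminf (\<lambda>j. ?f j n)) \<longlonglongrightarrow> (\<Sum>j. summand 0 j * weight_inf c)"
  proof (intro tannerys_theorem[THEN conjunct2, THEN conjunct2])
    show "\<forall>\<^sub>F (j, n) in sequentially \<times>\<^sub>F sequentially. norm (?f j n) \<le> K * a ^ j * B"
      using bd by (intro always_eventually) auto
    show "summable (\<lambda>j. K * a ^ j * B)"
      using a by (intro summable_mult summable_mult2 summable_geometric) auto
  qed (use lim in auto)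
  moreover have "suminf (\<lambda>j. ?f j n) = diag_sum c n" for n
    unfolding diag_sum_def by (subst suminf_finite[of "{..n}"]) auto
  ultimately show ?thesis by simp
qed

text \<open>The same series at \<open>c = 0\<close> occurs in the limit for every initial
  \<open>c\<close>; the constant value 1 along \<open>c = 1\<close> identifies it as
  \<open>1 / weight_inf 1\<close>.\<close>

lemma diag_sum_LIMSEQ:
  assumes c: "0 \<le> c" "c \<le> 1"
  shows "diag_sum c \<longlonglongrightarrow> weight_inf c / weight_inf 1"
proof -
  obtain K where K: "\<And>c j. 0 \<le> c \<Longrightarrow> c \<le> 1 \<Longrightarrow> \<bar>summand c j\<bar> \<le> K * a ^ j"
    using summand_bound by blast
  have "summable (summand 0)"
    by (rule summable_comparison_test'[of "\<lambda>j. K * a ^ j" 0]) (use a K in \<open>auto intro!: summable_mult\<close>)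
  hence mult: "(\<Sum>j. summand 0 j * x) = (\<Sum>j. summand 0 j) * x" for x
    by (rule suminf_mult2 [symmetric])
  have "(\<lambda>n. 1) \<longlonglongrightarrow> (\<Sum>j. summand 0 j) * weight_inf 1"
    using diag_sum_LIMSEQ_aux[of 1] by (simp add: diag_sum_1 [abs_def] mult)
  hence "(\<Sum>j. summand 0 j) * weight_inf 1 = 1"
    by (simp add: LIMSEQ_const_iff)
  hence "(\<Sum>j. summand 0 j) = 1 / weight_inf 1"
    using weight_inf_pos[of 1] by (simp add: field_simps)
  thus ?thesis using diag_sum_LIMSEQ_aux[OF c] by (simp add: mult)
qed

section \<open>Product formulas for the diagonal terms\<close>

text \<open>Extracting \<open>- (p ^ (2 * i))\<close> from each factor leaves
  \<open>1 - c * p ^ (2 * (n - i))\<close>, which are the factors on the right in reverse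
  order.\<close>

lemma shifted_diag: "shifted (c * p ^ (2 * n)) n = (\<Prod>i<n. - (p ^ (2 * i))) * qpoch (c * p\<^sup>2) (p\<^sup>2) n"
proof (induction n)
  case 0 thus ?case by (simp add: shifted_def)
next
  case (Suc n)
  have e: "c * p ^ (2 * Suc n) = c * p ^ (2 * n) * p\<^sup>2"
    by (simp add: power_add power2_eq_square mult_ac)
  show ?case unfolding e shifted_dilate Suc
    by (simp add: qpoch_Suc power_mult [symmetric] algebra_simps)
qed

text \<open>Joins the denominators of \<open>weight\<close> and of the summand or certificate;
  \<open>k = n\<close> produces the index \<open>3 * n\<close> of the theorem.\<close>

lemma qpoch_merge: "qpoch (a * p * c) p (2 * n) * qpoch (a * p * (c * p ^ (2 * n))) p k = qpoch (a * p * c) p (2 * n + k)"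
  unfolding qpoch_add by (simp add: mult_ac)

lemma summand_diag: "summand (c * p ^ (2 * n)) n * weight c n =
    (1 - a * p ^ (3 * n)) * numer n * (\<Prod>i<n. - (p ^ (2 * i))) * qpoch (c * p\<^sup>2) (p\<^sup>2) n
    * qpoch (a * b * p * c) (p\<^sup>2) n * qpoch (a * e * p * c) (p\<^sup>2) n / (denom n * qpoch (a * p * c) p (3 * n))"
  unfolding summand_def weight_def shifted_diag using qpoch_merge[of c n n] by (simp add: mult_ac)

text \<open>Boundary term and next diagonal term share the product \<open>X\<close>, so their ratio
  is rational. The relation is cross-multiplied, and the factors on the left are cancelled after
  specialisation.\<close>

lemma cert_diag:
  assumes "0 \<le> c" "c \<le> 1"
  shows "weight c n * cert (c * p ^ (2 * n)) (Suc n) * ((1 - a * p ^ (3 * Suc n)) * (1 - p ^ (2 * n) * (c * p\<^sup>2))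
      * (1 - p ^ (2 * n) * (a * b * p * c)) * (1 - p ^ (2 * n) * (a * e * p * c)))
    = - c * (1 - p ^ (2 * n) * p\<^sup>2) * (1 - p ^ (2 * n) * (a * p * e)) * (1 - p ^ (2 * n) * (a * b * p))
      * (1 - p ^ (3 * n + 2) * (a * p * c)) * (summand (c * p ^ (2 * Suc n)) (Suc n) * weight c (Suc n))"
proof -
  define d where "d = (1 - p^(2*n) * p\<^sup>2) * (1 - p^(2*n) * (a * p * e)) * (1 - p^(2*n) * (a * b * p))"
  define r where "r = 1 - p ^ (3 * n + 2) * (a * p * c)"
  define R where "R = qpoch (a * p * c) p (3 * n + 2)"
  define X where "X = numer (Suc n) * (\<Prod>i<n. - (p ^ (2 * i))) * qpoch (c * p\<^sup>2) (p\<^sup>2) n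
    * qpoch (a * b * p * c) (p\<^sup>2) n * qpoch (a * e * p * c) (p\<^sup>2) n"
  define Y where "Y = (1 - p ^ (2 * n) * (c * p\<^sup>2)) * (1 - p ^ (2 * n) * (a * b * p * c))
    * (1 - p ^ (2 * n) * (a * e * p * c))"
  have dS: "denom (Suc n) = denom n * d"
    by (simp add: denom_Suc d_def)
  \<comment> \<open>The boundary term carries \<open>3 * n + 2\<close> factors and the next diagonal
    term one more, namely \<open>r\<close>.\<close>
  have "3 * Suc n = Suc (3 * n + 2)" by simp
  hence RS: "qpoch (a * p * c) p (3 * Suc n) = R * r"
    by (simp only: qpoch_Suc R_def r_def)
  have nz: "denom n \<noteq> 0" "d \<noteq> 0" "R \<noteq> 0" "r \<noteq> 0"
    using denom_pos[of n] denom_pos[of "Suc n"] qpoch_apc_pos[OF assms, of "3 * n + 2"]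
      qpoch_apc_pos[OF assms, of "3 * Suc n"] unfolding dS RS R_def by auto
  have G: "weight c n * cert (c * p ^ (2 * n)) (Suc n) = c * p ^ (2 * n) * X / (denom n * R)"
    unfolding cert_def weight_def nat.case shifted_diag X_def R_def
    using qpoch_merge[of c n "n + 2"] by (simp add: mult_ac)
  have T: "summand (c * p ^ (2 * Suc n)) (Suc n) * weight c (Suc n)
      = (1 - a * p ^ (3 * Suc n)) * - (p ^ (2 * n)) * X * Y / (denom n * d * (R * r))"
    unfolding summand_diag dS RS X_def Y_def
    by (simp add: qpoch_Suc power_mult [symmetric] del: mult_Suc_right)
  show ?thesis
    unfolding G T d_def [symmetric] r_def [symmetric] using nz
    by (simp add: divide_simps Y_def del: mult_Suc_right) (simp add: d_def)
qed

end

section \<open>Specialisation to powers of \<open>t\<close>, where \<open>q = t ^ 6\<close>\<close>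

lemma qpoch_inf_double:
  assumes "0 \<le> p" "p < 1"
  shows "qpoch_inf x p = qpoch_inf x (p\<^sup>2) * qpoch_inf (p * x) (p\<^sup>2)"
proof (rule LIMSEQ_unique)
  have p2: "0 \<le> p\<^sup>2" "p\<^sup>2 < 1"
    using assms by (auto simp: power_less_one_iff abs_square_less_1)
  show "(\<lambda>n. qpoch x p (2 * n)) \<longlonglongrightarrow> qpoch_inf x p"
    using LIMSEQ_subseq_LIMSEQ[OF qpoch_LIMSEQ[OF assms], of "\<lambda>n. 2 * n" x]
    by (auto simp: strict_mono_def o_def)
  show "(\<lambda>n. qpoch x p (2 * n)) \<longlonglongrightarrow> qpoch_inf x (p\<^sup>2) * qpoch_inf (p * x) (p\<^sup>2)"
    unfolding qpoch_double by (intro tendsto_mult qpoch_LIMSEQ p2)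
qed

text \<open>The final product is \<open>t ^ (n * (9 * n + 1) / 2)\<close>, that is
  \<open>q powr (n * (9 * n + 1) / 12)\<close>, in a form without halved exponents.\<close>

definition base_term :: "real \<Rightarrow> nat \<Rightarrow> real" where
  "base_term t n = (-1) ^ n * (qpoch (t^2) (t^6) n * qpoch t (t^6) n
     * ((qpoch (t^2) (t^3) n)\<^sup>2 * qpoch (t^4) (t^3) n))
     / ((qpoch (t^6) (t^6) n)\<^sup>2 * qpoch (t^6) (t^3) (3 * n)) * (\<Prod>i<n. t ^ (9 * i + 5))"

definition bracket :: "real \<Rightarrow> nat \<Rightarrow> real" where
  "bracket t n = t ^ (6 * n + 1) * ((1 - t ^ (6 * n)) / (1 - t^2))
     + (1 + t ^ (3 * n + 1)) * (1 - t ^ (15 * n + 2)) / ((1 + t) * (1 - t^2))"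

lemma sums_base_term:
  fixes t :: real
  assumes t: "0 < t" "t < 1"
  shows "(\<lambda>n. base_term t n * bracket t n) sums
    ((qpoch_inf (t^8) (t^6))\<^sup>2 * qpoch_inf (t^5) (t^6) / ((qpoch_inf (t^6) (t^6))\<^sup>2 * qpoch_inf (t^9) (t^6)))"
proof -
  have tl: "t ^ k < 1" if "k > 0" for k using t that by (simp add: power_less_one_iff)
  interpret quadratic_wz "t^3" "t^2" "t^2" t
    using t tl[of 2] tl[of 3] by unfold_locales (simp_all add: eval_nat_numeral mult.assoc)
  have t36: "(t^3)\<^sup>2 = t^6" by simp
  have c: "0 \<le> t" "t \<le> 1" using t by auto
  have nz: "1 - t > 0" "1 - t^2 > 0" "1 - t ^ (3*n+1) > 0" "1 - t ^ (6*n+2) > 0" for n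
    using t tl[of 2] tl[of "3*n+1"] tl[of "6*n+2"] by simp_all
  have pos: "0 < qpoch (t^k) (t^m) n" if "k > 0" "m > 0" for k m n
    using t tl[OF that(1)] tl[OF that(2)] by (intro qpoch_pos) auto
  define E where "E n = (\<Prod>i<n. t ^ (9 * i + 5))" for n
  \<comment> \<open>The power in \<open>numer\<close> meets the signs and powers from
    \<open>shifted_diag\<close>; the exponents add up to
    \<open>2 + 3 * (i + 1) + 6 * i\<close>.\<close>
  have E: "(\<Prod>i<n. t\<^sup>2 * (t ^ 3) ^ Suc i) * (\<Prod>i<n. - ((t ^ 3) ^ (2 * i))) = (-1) ^ n * E n" for n
  proof (induction n)
    case (Suc n)
    have "t\<^sup>2 * (t ^ 3) ^ Suc n * (t ^ 3) ^ (2 * n) = t ^ (9 * n + 5)"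
      by (simp add: power_mult [symmetric] power_add [symmetric] algebra_simps flip: power_Suc)
    hence "t\<^sup>2 * (t ^ 3) ^ Suc n * - ((t ^ 3) ^ (2 * n)) = - (t ^ (9 * n + 5))"
      by simp
    thus ?case using Suc by (simp add: E_def algebra_simps)
  qed (simp add: E_def)
  \<comment> \<open>The diagonal summand contains products starting at \<open>t\<close>,
    \<open>t^8\<close>, \<open>t^7\<close> where \<open>base_term\<close> has \<open>t^4\<close>,
    \<open>t^2\<close>, \<open>t\<close>. Each differs by one step of its base, and
    \<open>qpoch_shift\<close> turns these steps into the rational factor.\<close>
  have summand_term: "summand (t * (t^3) ^ (2 * n)) n * weight t n = base_term t n *
      ((1 - t ^ (9*n+2)) * (1 + t ^ (3*n+1)) * (1 - t ^ (6*n+1)) / (1 - t\<^sup>2)\<^sup>2)" for n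
  proof -
    define X where "X = qpoch (t^2) (t^3) n"
    define Y where "Y = qpoch t (t^3) n"
    define Y4 where "Y4 = qpoch (t^4) (t^3) n"
    define Z where "Z k = qpoch (t^k) (t^6) n" for k
    define R where "R = qpoch (t^6) (t^3) (3 * n)"
    have nz': "1 - t^2 \<noteq> 0" "1 - t \<noteq> 0" "1 - t ^ (3*n+1) \<noteq> 0" "Z 6 \<noteq> 0" "Z 7 \<noteq> 0" "R \<noteq> 0"
      using nz pos[of 6 6 n] pos[of 7 6 n] pos[of 6 3 "3 * n"] by (auto simp: Z_def R_def less_le)
    have "(1 - t) * Y4 = Y * (1 - t ^ (3*n+1))"
    proof -
      have "t^3 * t = t^4" by (simp add: eval_nat_numeral)
      moreover have "(t^3) ^ n * t = t ^ (3*n+1)" by (simp add: power_mult)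
      ultimately show ?thesis using qpoch_shift[of t "t^3" n] by (simp add: Y_def Y4_def)
    qed
    hence Y: "Y = (1 - t) * Y4 / (1 - t ^ (3*n+1))"
      using nz' by (simp add: field_simps)
    have Z: "(1 - t^k) * Z (6 + k) = Z k * (1 - t ^ (6*n+k))" for k
    proof -
      have "t^6 * t^k = t ^ (6+k)" "(t^6) ^ n * t^k = t ^ (6*n+k)"
        by (simp_all add: power_mult power_add)
      thus ?thesis using qpoch_shift[of "t^k" "t^6" n] by (simp add: Z_def)
    qed
    have Z8: "Z 8 = Z 2 * (1 - t ^ (6*n+2)) / (1 - t^2)" and Z7: "Z 7 = Z 1 * (1 - t ^ (6*n+1)) / (1 - t)"
      using Z[of 2] Z[of 1] nz' by (simp_all add: eq_divide_eq mult.commute)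
    have e: "t\<^sup>2 * t\<^sup>2 * t^3 * t = t^8" "t\<^sup>2 * t * t^3 * t = t^7" "t\<^sup>2 * t^3 * t = t^6"
      "t\<^sup>2 * t\<^sup>2 * t^3 = t^7" "t * t^6 = t^7" "t^7 * t = t^8"
      by (simp_all add: eval_nat_numeral)
    have "t\<^sup>2 * (t^3) ^ (3 * n) = t ^ (9*n+2)"
      unfolding power_mult [symmetric] power_add [symmetric] by (simp add: add.commute)
    hence "summand (t * (t^3) ^ (2 * n)) n * weight t n = (1 - t ^ (9*n+2)) * (X\<^sup>2 * Y / (1 - t^2))
       * ((\<Prod>i<n. t\<^sup>2 * (t ^ 3) ^ Suc i) * (\<Prod>i<n. - ((t ^ 3) ^ (2 * i)))) * Z 7 * Z 8 * Z 7 / ((Z 6)\<^sup>2 * Z 7 * R)"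
      unfolding summand_diag numer_def denom_def t36 e X_def Y_def Z_def R_def
      by (simp add: power2_eq_square [of "qpoch _ _ _"] mult_ac)
    also have "\<dots> = (1 - t ^ (9*n+2)) * (X\<^sup>2 * Y / (1 - t^2)) * ((-1) ^ n * E n) * Z 7 * Z 8 / ((Z 6)\<^sup>2 * R)"
      unfolding E using nz' by simp
    also have "\<dots> = (-1) ^ n * (Z 2 * Z 1 * (X\<^sup>2 * Y4)) / ((Z 6)\<^sup>2 * R) * E n
      * ((1 - t ^ (9*n+2)) * ((1 - t ^ (6*n+2)) / (1 - t ^ (3*n+1))) * (1 - t ^ (6*n+1)) / (1 - t\<^sup>2)\<^sup>2)"
      unfolding Y Z7 Z8 using nz' by (simp add: power2_eq_square mult_ac)
    also have "(1 - t ^ (6*n+2)) / (1 - t ^ (3*n+1)) = 1 + t ^ (3*n+1)"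
    proof -
      have "t ^ (6*n+2) = (t ^ (3*n+1))\<^sup>2"
        unfolding power_mult [symmetric] by (simp add: algebra_simps)
      thus ?thesis using nz'(3) by (simp add: divide_simps) (simp add: power2_eq_square algebra_simps)
    qed
    finally show ?thesis
      unfolding base_term_def E_def X_def Y4_def Z_def R_def by simp
  qed
  \<comment> \<open>The boundary term entering the sum at \<open>n\<close> belongs to the dilation
    index \<open>n - 1\<close>, hence the form \<open>n = Suc m\<close>.\<close>
  have cert_term: "weight t m * cert (t * (t^3) ^ (2 * m)) (Suc m) = base_term t n *
      (- t * (1 - t ^ (6*n))\<^sup>2 * (1 + t ^ (3*n+1) + t ^ (6*n+2)) / (1 - t\<^sup>2)\<^sup>2)" if n: "n = Suc m" for n m
  proof -
    define y where "y = t ^ (3 * n)"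
    have y: "t ^ (6*n) = y^2" "t ^ (9*n) = y^3"
      by (simp_all add: y_def power_mult [symmetric] mult_ac)
    have y': "t ^ (6*m) * t^6 = y^2" "t ^ (9*m) * t^9 = y^3"
      unfolding y [symmetric] by (simp_all add: n power_add)
    have ynz: "1 - t^2 * y^3 \<noteq> 0" "1 - t * y^2 \<noteq> 0" "1 - t^2 * y^2 \<noteq> 0" "1 - t * y \<noteq> 0"
      using tl[of "9*n+2"] tl[of "6*n+1"] tl[of "6*n+2"] tl[of "3*n+1"]
      unfolding power_add y y_def [symmetric] power_one_right by (simp_all add: mult.commute)
    have pp: "(t^3) ^ (2 * m) = t ^ (6*m)" "(t^3) ^ (3 * m + 2) = t ^ (9*m) * t^6" "(t^3) ^ (3 * Suc m) = t ^ (9*m) * t^9"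
      by (simp_all add: power_mult [symmetric] power_add [symmetric] algebra_simps del: mult_Suc_right)
    have e: "t ^ (6*m) * (t * t^6) = t * y^2" "t ^ (6*m) * (t\<^sup>2 * t\<^sup>2 * t^3 * t) = t^2 * y^2"
      "t ^ (6*m) * (t\<^sup>2 * t * t^3 * t) = t * y^2" "t ^ (6*m) * t^6 = y^2"
      "t ^ (6*m) * (t\<^sup>2 * t^3 * t) = y^2" "t ^ (6*m) * (t\<^sup>2 * t\<^sup>2 * t^3) = t * y^2"
      "t ^ (9*m) * t^6 * (t\<^sup>2 * t^3 * t) = t^3 * y^3" "t\<^sup>2 * (t ^ (9*m) * t^9) = t^2 * y^3"
      unfolding y' [symmetric] by (simp_all add: eval_nat_numeral mult_ac)
    \<comment> \<open>The left-hand factor of \<open>cert_diag\<close> at \<open>c = t\<close>,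
      nonzero and therefore cancellable.\<close>
    define D where "D = (1 - t^2 * y^3) * (1 - t * y^2) * (1 - t^2 * y^2) * (1 - t * y^2)"
    define k where "k = (1 - t\<^sup>2)\<^sup>2"
    have Dk: "D \<noteq> 0" "k \<noteq> 0" using ynz nz by (auto simp: D_def k_def)
    have "weight t m * cert (t * (t^3) ^ (2 * m)) n * D = - t * (1 - y^2) * (1 - y^2) * (1 - t * y^2) * (1 - t^3 * y^3)
       * (base_term t n * ((1 - y^3 * t\<^sup>2) * (1 + y * t) * (1 - y^2 * t) / k))"
      using cert_diag[OF c, of m, unfolded t36 pp, unfolded e, folded n, unfolded summand_term]
      unfolding pp power_add y y_def [symmetric] D_def k_def by simp
    \<comment> \<open>Here \<open>1 - t^3 * y^3\<close> gives up a factor \<open>1 - t * y\<close>,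
      which combines with \<open>1 + t * y\<close> to the factor \<open>1 - t^2 * y^2\<close> of
      \<open>D\<close>.\<close>
    also have "\<dots> = base_term t n * (- t * (1 - y^2)\<^sup>2 * (1 + y * t + y^2 * t^2) / k) * D"
      using Dk(2) unfolding D_def by (simp add: divide_simps) algebra
    finally have "weight t m * cert (t * (t^3) ^ (2 * m)) n = base_term t n * (- t * (1 - y^2)\<^sup>2 * (1 + y * t + y^2 * t^2) / k)"
      using Dk(1) by (rule mult_right_cancel [THEN iffD1, rotated])
    thus ?thesis
      unfolding k_def n [symmetric] power_add y y_def [symmetric] by simp
  qed
  \<comment> \<open>The bracket is the certificate part plus the new diagonal part, as a whole and
    not summand by summand. At \<open>n = 0\<close> the certificate part vanishes.\<close>
  have brk: "bracket t n = (- t * (1 - t ^ (6*n))\<^sup>2 * (1 + t ^ (3*n+1) + t ^ (6*n+2)) / (1 - t\<^sup>2)\<^sup>2)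
     + ((1 - t ^ (9*n+2)) * (1 + t ^ (3*n+1)) * (1 - t ^ (6*n+1)) / (1 - t\<^sup>2)\<^sup>2)" for n
  proof -
    define y where "y = t ^ (3 * n)"
    have y: "t ^ (6*n) = y^2" "t ^ (9*n) = y^3" "t ^ (15*n) = y^5"
      by (simp_all add: y_def power_mult [symmetric] mult_ac)
    have k: "(1 + t) * (1 - t^2) \<noteq> 0" "1 - t \<noteq> 0"
      using nz t by simp_all
    have k3: "(1 - t\<^sup>2)\<^sup>2 = (1 + t) * (1 - t^2) * (1 - t)"
      by algebra
    have "bracket t n = (y\<^sup>2 * t * (1 - y\<^sup>2) * (1 + t) + (1 + y * t) * (1 - y^5 * t\<^sup>2)) / ((1 + t) * (1 - t^2))"
      using k(1) unfolding bracket_def power_add y y_def [symmetric] by (simp add: divide_simps)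
    also have "\<dots> = (y\<^sup>2 * t * (1 - y\<^sup>2) * (1 + t) + (1 + y * t) * (1 - y^5 * t\<^sup>2)) * (1 - t) / (1 - t\<^sup>2)\<^sup>2"
      unfolding k3 using k(2) by simp
    also have "(y\<^sup>2 * t * (1 - y\<^sup>2) * (1 + t) + (1 + y * t) * (1 - y^5 * t\<^sup>2)) * (1 - t)
        = - t * (1 - y\<^sup>2)\<^sup>2 * (1 + y * t + y\<^sup>2 * t\<^sup>2) + (1 - y^3 * t\<^sup>2) * (1 + y * t) * (1 - y\<^sup>2 * t)"
      by algebra
    finally show ?thesis
      unfolding power_add y y_def [symmetric] by (simp add: diff_divide_distrib)
  qed
  have partial: "(\<Sum>i<Suc n. base_term t i * bracket t i) = diag_sum t n" for n
  proof (induction n)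
    case 0
    have "bracket t 0 = 1" using nz t by (simp add: bracket_def power2_eq_square)
    thus ?case by (simp add: diag_sum_0 base_term_def)
  next
    case (Suc n)
    have "(\<Sum>i<Suc (Suc n). base_term t i * bracket t i) = diag_sum t n + base_term t (Suc n) * bracket t (Suc n)"
      using Suc by simp
    also have "\<dots> = diag_sum t (Suc n)"
      unfolding diag_sum_Suc[OF c] brk distrib_left summand_term cert_term[OF refl] by simp
    finally show ?case .
  qed
  \<comment> \<open>Splitting the base \<open>t^3\<close> products into base \<open>t^6\<close>
    leaves a common \<open>t^7\<close> product, which cancels.\<close>
  have "weight_inf t / weight_inf 1 = (qpoch_inf (t^8) (t^6))\<^sup>2 * qpoch_inf (t^5) (t^6) / ((qpoch_inf (t^6) (t^6))\<^sup>2 * qpoch_inf (t^9) (t^6))"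
  proof -
    have ip: "0 < qpoch_inf (t^k) (t^6)" if "k > 0" for k
      using t tl[of 6] tl[OF that] by (intro qpoch_inf_pos) auto
    have d: "qpoch_inf (t^k) (t^3) = qpoch_inf (t^k) (t^6) * qpoch_inf (t^(3+k)) (t^6)" for k
      using qpoch_inf_double[of "t^3" "t^k"] t tl[of 3] by (simp add: power_add)
    have e: "t\<^sup>2 * t\<^sup>2 * t^3 * t = t^8" "t\<^sup>2 * t * t^3 * t = t^7" "t\<^sup>2 * t^3 * t = t^6"
      "t\<^sup>2 * t\<^sup>2 * t^3 * 1 = t^7" "t\<^sup>2 * t * t^3 * 1 = t^6" "t\<^sup>2 * t^3 * 1 = t^5"
      by (simp_all add: power2_eq_square eval_nat_numeral)
    have w_t: "weight_inf t = qpoch_inf (t^8) (t^6) * qpoch_inf (t^7) (t^6) / (qpoch_inf (t^6) (t^6) * qpoch_inf (t^9) (t^6))"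
      unfolding weight_inf_def e t36 d by simp
    have w_1: "weight_inf 1 = qpoch_inf (t^7) (t^6) * qpoch_inf (t^6) (t^6) / (qpoch_inf (t^5) (t^6) * qpoch_inf (t^8) (t^6))"
      unfolding weight_inf_def e t36 d by simp
    show ?thesis
      unfolding w_t w_1 using ip[of 5] ip[of 6] ip[of 7] ip[of 8] ip[of 9]
      by (simp add: field_simps power2_eq_square)
  qed
  hence "(\<lambda>n. \<Sum>i<Suc n. base_term t i * bracket t i) \<longlonglongrightarrow>
    (qpoch_inf (t^8) (t^6))\<^sup>2 * qpoch_inf (t^5) (t^6) / ((qpoch_inf (t^6) (t^6))\<^sup>2 * qpoch_inf (t^9) (t^6))"
    using diag_sum_LIMSEQ[OF c] by (simp only: partial)
  thus ?thesis
    unfolding sums_def by (rule LIMSEQ_imp_Suc)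
qed

section \<open>Return from powers of \<open>t\<close> to fractional powers of
  \<open>q\<close>\<close>

theorem mainTheorem9:
  fixes q :: real
  assumes "0 < q" and "q < 1"
  shows "(\<lambda>n::nat.
      (-1) ^ n
      * (qpochs [q powr (1/3), q powr (1/6)] q n
         * qpochs [q powr (1/3), q powr (1/3), q powr (2/3)] (q powr (1/2)) n)
      / (qpochs [q, q] q n * qpoch q (q powr (1/2)) (3 * n))
      * q powr (real n * (9 * real n + 1) / 12)
      * (q powr (real n + 1/6) * ((1 - q ^ n) / (1 - q powr (1/3)))
         + (1 + q powr (real n / 2 + 1/6)) * (1 - q powr (5 * real n / 2 + 1/3))
           / ((1 + q powr (1/6)) * (1 - q powr (1/3)))))
    sums
      ((qpoch_inf (q powr (4/3)) q)\<^sup>2 * qpoch_inf (q powr (5/6)) q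
       / ((qpoch_inf q q)\<^sup>2 * qpoch_inf (q powr (3/2)) q))"
proof -
  define t where "t = q powr (1/6)"
  have t: "0 < t" "t < 1"
    using assms powr_less_mono2[of "1/6" q 1] by (simp_all add: t_def)
  have pw: "q powr x = t ^ k" if "6 * x = real k" for x k
  proof -
    have "t ^ k = q powr (1/6 * (6 * x))"
      unfolding that t_def using assms by (simp add: powr_realpow [symmetric] powr_powr)
    thus ?thesis by simp
  qed
  have q: "q = t ^ 6" using pw[of 1 6] assms by simp
  have q1: "q powr (1/3) = t^2" "q powr (1/6) = t" "q powr (2/3) = t^4" "q powr (1/2) = t^3"
    "q powr (4/3) = t^8" "q powr (5/6) = t^5" "q powr (3/2) = t^9"
    using pw[of "1/3" 2] pw[of "1/6" 1] pw[of "2/3" 4] pw[of "1/2" 3] pw[of "4/3" 8] pw[of "5/6" 5] pw[of "3/2" 9]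
    by simp_all
  have q2: "q powr (real n + 1/6) = t ^ (6*n+1)" "q powr (real n / 2 + 1/6) = t ^ (3*n+1)"
    "q powr (5 * real n / 2 + 1/3) = t ^ (15*n+2)" "q ^ n = t ^ (6*n)" for n
    using pw[of "real n + 1/6" "6*n+1"] pw[of "real n / 2 + 1/6" "3*n+1"] pw[of "5 * real n / 2 + 1/3" "15*n+2"]
    by (simp_all add: q power_mult)
  have q3: "q powr (real n * (9 * real n + 1) / 12) = (\<Prod>i<n. t ^ (9 * i + 5))" for n
  proof (induction n)
    case 0 thus ?case using assms by simp
  next
    case (Suc n)
    \<comment> \<open>Passing from \<open>n\<close> to \<open>n + 1\<close> raises the quadratic
      exponent by \<open>(9 * n + 5) / 6\<close>.\<close>
    have "q powr (real (Suc n) * (9 * real (Suc n) + 1) / 12)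
       = q powr (real n * (9 * real n + 1) / 12) * q powr ((9 * real n + 5) / 6)"
      unfolding powr_add [symmetric] by (rule arg_cong[of _ _ "(powr) q"]) (simp add: field_simps)
    also have "q powr ((9 * real n + 5) / 6) = t ^ (9 * n + 5)"
      by (rule pw) simp
    finally show ?case using Suc by simp
  qed
  show ?thesis
    using sums_base_term[OF t] unfolding q1 q2 q3 base_term_def bracket_def qpochs_def q [symmetric]
    by (simp add: power2_eq_square mult_ac)
qed

end
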